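(* Let $n$ guests be labeled $1,\dots,n$, and let $\mathcal{M}$ be a matroid on ground set $[n]$ with rank $k\le n$ and rank function $r$. Suppose the guests are $\mathcal{M}$-hungry and have closed preference sets. Then there exist $k$ guests forming a basis of $\mathcal{M}$ and a partition of $[0,1]$ into $k$ subintervals together with a bijective allocation of these subintervals to those $k$ guests that is envy-free for them (each of these guests prefers the piece allocated to them, i.e. likes it at least as much as any other piece of the partition).
   Context: The cake is the interval $[0,1]$. A partition of $[0,1]$ into $k$ subintervals has pieces $1,\dots,k$ numbered from left to right (pieces may have length zero). Each guest, given any partition of the cake into $k$ pieces, prefers one or more of the pieces. Preference sets are closed: if a guest prefers piece $i$ in each partition of a converging sequence of partitions, then the guest prefers piece $i$ in the limit partition. The guests are $\mathcal{M}$-hungry if for every $G\subseteq[n]$ with $r([n]\setminus G)\le k-1$ and every partition of $[0,1]$ into $k$ subintervals, some guest from $G$ prefers a positive-length piece of the partition. Here $r$ is the rank function of $\mathcal{M}$ (size of a largest independent subset), and a basis is an independent set of size $k$. *)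

theory Defs
  imports "HOL-Analysis.Analysis"
begin

definition matroid :: "'a set \<Rightarrow> 'a set set \<Rightarrow> bool" where
  "matroid E \<I> \<longleftrightarrow>
     finite E \<and>
     \<I> \<subseteq> Pow E \<and>
     {} \<in> \<I> \<and>
     (\<forall>I\<in>\<I>. \<forall>J. J \<subseteq> I \<longrightarrow> J \<in> \<I>) \<and>
     (\<forall>I\<in>\<I>. \<forall>J\<in>\<I>. card I < card J \<longrightarrow> (\<exists>e\<in>J - I. insert e I \<in> \<I>))"

definition matroid_rank :: "'a set set \<Rightarrow> 'a set \<Rightarrow> nat" where
  "matroid_rank \<I> A = Max (card ` {I \<in> \<I>. I \<subseteq> A})"

definition matroid_basis :: "'a set \<Rightarrow> 'a set set \<Rightarrow> 'a set \<Rightarrow> bool" where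
  "matroid_basis E \<I> B \<longleftrightarrow> B \<in> \<I> \<and> card B = matroid_rank \<I> E"

text \<open>
  A partition of the cake into \<open>k\<close> pieces is given by its cut points
  \<open>0 = x 0 \<le> x 1 \<le> \<dots> \<le> x k = 1\<close>; piece \<open>i\<close> (for \<open>1 \<le> i \<le> k\<close>) is the interval from
  \<open>x (i - 1)\<close> to \<open>x i\<close>.  Fixing \<open>x i = 1\<close> beyond \<open>k\<close> makes the representation unique, so a
  preference, which is a function of \<open>x\<close>, depends on the partition only.  There is no partition
  into \<open>0\<close> pieces.
\<close>

definition cake_partitions :: "nat \<Rightarrow> (nat \<Rightarrow> real) set" where
  "cake_partitions k = {x. x 0 = 0 \<and> mono x \<and> (\<forall>i\<ge>k. x i = 1)}"

definition piece_length :: "(nat \<Rightarrow> real) \<Rightarrow> nat \<Rightarrow> real" where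
  "piece_length x i = x i - x (i - 1)"

text \<open>In the following, \<open>P j x\<close> is the set of pieces that guest \<open>j\<close> prefers in partition \<open>x\<close>.\<close>

definition preferences :: "nat \<Rightarrow> 'g set \<Rightarrow> ('g \<Rightarrow> (nat \<Rightarrow> real) \<Rightarrow> nat set) \<Rightarrow> bool" where
  "preferences k N P \<longleftrightarrow>
     (\<forall>j\<in>N. \<forall>x\<in>cake_partitions k. P j x \<noteq> {} \<and> P j x \<subseteq> {1..k})"

definition closed_preferences :: "nat \<Rightarrow> 'g set \<Rightarrow> ('g \<Rightarrow> (nat \<Rightarrow> real) \<Rightarrow> nat set) \<Rightarrow> bool" where
  "closed_preferences k N P \<longleftrightarrow>
     (\<forall>j\<in>N. \<forall>i\<in>{1..k}. \<forall>X. \<forall>x\<in>cake_partitions k.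
        (\<forall>m::nat. X m \<in> cake_partitions k \<and> i \<in> P j (X m)) \<and>
        (\<forall>l. (\<lambda>m. X m l) \<longlonglongrightarrow> x l) \<longrightarrow> i \<in> P j x)"

definition matroid_hungry ::
  "nat \<Rightarrow> 'g set \<Rightarrow> 'g set set \<Rightarrow> ('g \<Rightarrow> (nat \<Rightarrow> real) \<Rightarrow> nat set) \<Rightarrow> bool" where
  "matroid_hungry k N \<I> P \<longleftrightarrow>
     (\<forall>G\<subseteq>N. matroid_rank \<I> (N - G) \<le> k - 1 \<longrightarrow>
        (\<forall>x\<in>cake_partitions k. \<exists>j\<in>G. \<exists>i\<in>{1..k}. i \<in> P j x \<and> piece_length x i > 0))"

end

theory Submission
  imports Defs
begin

text \<open>
  Hungriness says that at every partition the guests who prefer a piece of positive length contain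
  a basis. So, for small \<open>\<delta>\<close>, a partition of unity indexed by pairs \<open>(B, \<sigma>)\<close> of a basis and a map
  from \<open>B\<close> to pieces, supported where each \<open>j \<in> B\<close> prefers \<open>\<sigma> j\<close> in one common partition at
  distance less than \<open>\<delta>\<close> and all these pieces have positive length, gives each piece \<open>i\<close> the mass
  \<open>m i x\<close>, the mean size of the fibre of \<open>\<sigma>\<close> over \<open>i\<close>. The masses add up to \<open>k\<close> and vanish on empty
  pieces, so by a Sperner-type argument there is a partition at which every mass is \<open>1\<close>. There a set
  \<open>S\<close> of pieces has mass \<open>card S\<close>, which is at most the rank of the guests who almost prefer a piece
  in \<open>S\<close>, because each pair \<open>(B, \<sigma>)\<close> contributes the size of an independent set of such guests. Rado's
  theorem then yields a basis with an almost envy-free allocation, and \<open>\<delta> \<rightarrow> 0\<close> finishes the proof.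
\<close>

section \<open>Matroid rank and Rado's theorem\<close>

lemma rank_set_finite:
  assumes "matroid E \<I>"
  shows "finite {I \<in> \<I>. I \<subseteq> A}"
  using assms by (auto simp: matroid_def intro: finite_subset[of _ "Pow E"])

lemma matroid_rank_ge_card:
  assumes "matroid E \<I>" "I \<in> \<I>" "I \<subseteq> A"
  shows "card I \<le> matroid_rank \<I> A"
  unfolding matroid_rank_def
  using rank_set_finite[OF assms(1)] assms(2,3) by (intro Max_ge) auto

lemma matroid_rank_attained:
  assumes "matroid E \<I>"
  obtains I where "I \<in> \<I>" "I \<subseteq> A" "card I = matroid_rank \<I> A"
proof -
  have "Max (card ` {I \<in> \<I>. I \<subseteq> A}) \<in> card ` {I \<in> \<I>. I \<subseteq> A}"
    using rank_set_finite[OF assms] assms by (intro Max_in) (auto simp: matroid_def)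
  then show ?thesis using that by (auto simp: matroid_rank_def)
qed

lemma matroid_rank_mono:
  assumes "matroid E \<I>" "A \<subseteq> B"
  shows "matroid_rank \<I> A \<le> matroid_rank \<I> B"
  by (metis assms matroid_rank_attained matroid_rank_ge_card subset_trans)

lemma matroid_independent_finite:
  assumes "matroid E \<I>" "I \<in> \<I>"
  shows "finite I"
  using assms by (auto simp: matroid_def intro: finite_subset)

lemma matroid_independent_subset:
  assumes "matroid E \<I>" "I \<in> \<I>" "J \<subseteq> I"
  shows "J \<in> \<I>"
  using assms unfolding matroid_def by blast

lemma matroid_augment:
  assumes "matroid E \<I>" "I \<in> \<I>" "J \<in> \<I>" "card I < card J"
  shows "\<exists>e\<in>J - I. insert e I \<in> \<I>"
  using assms unfolding matroid_def by blast

lemma matroid_rank_le_card: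
  assumes "matroid E \<I>" "finite A"
  shows "matroid_rank \<I> A \<le> card A"
  by (metis assms card_mono matroid_rank_attained)

lemma matroid_independentI_rank:
  assumes "matroid E \<I>" "finite A" "card A \<le> matroid_rank \<I> A"
  shows "A \<in> \<I>"
  by (metis assms card_seteq matroid_rank_attained)

text \<open>As long as \<open>I\<close> is smaller than a maximum independent subset of
  \<open>A\<close>, augmentation from that subset enlarges it inside \<open>A\<close>; the gap to
  the rank decreases.\<close>

lemma matroid_extend_to_rank:
  assumes M: "matroid E \<I>" and "I \<in> \<I>" "I \<subseteq> A"
  obtains J where "J \<in> \<I>" "I \<subseteq> J" "J \<subseteq> A" "card J = matroid_rank \<I> A"
proof -
  have "\<exists>J\<in>\<I>. I \<subseteq> J \<and> J \<subseteq> A \<and> card J = matroid_rank \<I> A"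
    using assms(2,3)
  proof (induction "matroid_rank \<I> A - card I" arbitrary: I rule: less_induct)
    case less
    show ?case
    proof (cases "card I < matroid_rank \<I> A")
      case True
      obtain K where K: "K \<in> \<I>" "K \<subseteq> A" "card K = matroid_rank \<I> A"
        by (rule matroid_rank_attained[OF M])
      then obtain e where e: "e \<in> K - I" "insert e I \<in> \<I>"
        using matroid_augment[OF M less.prems(1) K(1)] True by auto
      have "card (insert e I) = Suc (card I)"
        using e matroid_independent_finite[OF M less.prems(1)] by simp
      then have "matroid_rank \<I> A - card (insert e I) < matroid_rank \<I> A - card I"
        using True by simp
      moreover have "insert e I \<subseteq> A" using e K less.prems by blast
      ultimately show ?thesis
        using less.hyps[of "insert e I"] e(2) by blast
    next
      case False
      then show ?thesis
        using less.prems matroid_rank_ge_card[OF M] by (metis le_antisym not_less order_refl)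
    qed
  qed
  then show ?thesis using that by blast
qed

text \<open>A maximum independent set \<open>I\<close> of \<open>A \<inter> B\<close> extends to a
  maximum independent set \<open>J\<close> of \<open>A \<union> B\<close>. The traces of
  \<open>J\<close> on \<open>A\<close> and \<open>B\<close> are independent, cover \<open>J\<close>
  and overlap in at least \<open>I\<close>, so counting them gives the inequality.\<close>

lemma matroid_rank_submodular:
  assumes M: "matroid E \<I>"
  shows "matroid_rank \<I> (A \<union> B) + matroid_rank \<I> (A \<inter> B) \<le> matroid_rank \<I> A + matroid_rank \<I> B"
proof -
  obtain I where I: "I \<in> \<I>" "I \<subseteq> A \<inter> B" "card I = matroid_rank \<I> (A \<inter> B)"
    using matroid_rank_attained[OF M] by blast
  then have "I \<subseteq> A \<union> B" by blast
  then obtain J where J: "J \<in> \<I>" "I \<subseteq> J" "J \<subseteq> A \<union> B" "card J = matroid_rank \<I> (A \<union> B)"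
    using matroid_extend_to_rank[OF M I(1)] by blast
  have fin: "finite J"
    using matroid_independent_finite[OF M J(1)] .
  have sub: "L \<in> \<I>" if "L \<subseteq> J" for L
    using matroid_independent_subset[OF M J(1) that] .
  have "card J + card I \<le> card ((J \<inter> A) \<union> (J \<inter> B)) + card ((J \<inter> A) \<inter> (J \<inter> B))"
    using I J fin by (intro add_mono card_mono) auto
  also have "\<dots> = card (J \<inter> A) + card (J \<inter> B)"
    using fin by (intro card_Un_Int[symmetric]) auto
  also have "\<dots> \<le> matroid_rank \<I> A + matroid_rank \<I> B"
    using matroid_rank_ge_card[OF M] sub by (intro add_mono) auto
  finally show ?thesis using I J by simp
qed

text \<open>Induction on the total size of the sets \<open>N i\<close>: while some set has two
  elements, one of them can be removed. Once all are singletons, the rank condition for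
  \<open>X\<close> itself forces the chosen elements to be distinct and independent.\<close>

theorem rado_independent_transversal:
  fixes N :: "'i \<Rightarrow> 'a set"
  assumes M: "matroid E \<I>" and "finite X" and "\<And>i. i \<in> X \<Longrightarrow> finite (N i)"
    and "\<And>S. S \<subseteq> X \<Longrightarrow> card S \<le> matroid_rank \<I> (\<Union>i\<in>S. N i)"
  shows "\<exists>f. (\<forall>i\<in>X. f i \<in> N i) \<and> inj_on f X \<and> f ` X \<in> \<I>"
  using assms(3,4)
proof (induction "\<Sum>i\<in>X. card (N i)" arbitrary: N rule: less_induct)
  case less
  note fin = less.prems(1) and rado = less.prems(2)
  have ne: "N i \<noteq> {}" if "i \<in> X" for i
    using rado[of "{i}"] that matroid_rank_le_card[OF M, of "N i"] by auto
  show ?case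
  proof (cases "\<exists>i\<in>X. \<exists>a\<in>N i. \<exists>b\<in>N i. a \<noteq> b")
    case False
    define f where "f i = (SOME a. a \<in> N i)" for i
    have f: "f i \<in> N i" if "i \<in> X" for i
      using ne[OF that] by (simp add: f_def some_in_eq)
    then have "N i = {f i}" if "i \<in> X" for i
      using False that by blast
    then have U: "(\<Union>i\<in>X. N i) = f ` X" by auto
    have le: "card X \<le> matroid_rank \<I> (f ` X)"
      using rado[of X] U by simp
    also have "\<dots> \<le> card (f ` X)"
      using matroid_rank_le_card[OF M] \<open>finite X\<close> by simp
    finally have card: "card (f ` X) = card X"
      using card_image_le[OF \<open>finite X\<close>, of f] by simp
    then have "inj_on f X" "f ` X \<in> \<I>"
      using \<open>finite X\<close> le matroid_independentI_rank[OF M, of "f ` X"]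
      by (auto intro: eq_card_imp_inj_on)
    then show ?thesis using f by blast
  next
    case True
    then obtain i a b where iab: "i \<in> X" "a \<in> N i" "b \<in> N i" "a \<noteq> b" by blast
    \<comment> \<open>By submodularity, one of \<open>a\<close>, \<open>b\<close> can be deleted from \<open>N i\<close> without violating the rank condition.\<close>
    have step: "\<exists>f. (\<forall>i\<in>X. f i \<in> N i) \<and> inj_on f X \<and> f ` X \<in> \<I>"
      if c: "c \<in> N i" and ok: "\<And>S. S \<subseteq> X - {i} \<Longrightarrow>
        Suc (card S) \<le> matroid_rank \<I> ((N i - {c}) \<union> (\<Union>j\<in>S. N j))" for c
    proof -
      let ?N = "N(i := N i - {c})"
      have "card (?N i) < card (N i)"
        using card_Diff1_less[OF fin[OF iab(1)] c] by simp
      then have "(\<Sum>j\<in>X. card (?N j)) < (\<Sum>j\<in>X. card (N j))"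
        using \<open>finite X\<close> iab by (intro sum_strict_mono_ex1) auto
      moreover have "card S \<le> matroid_rank \<I> (\<Union>j\<in>S. ?N j)" if S: "S \<subseteq> X" for S
      proof (cases "i \<in> S")
        case True
        then have "(\<Union>j\<in>S. ?N j) = (N i - {c}) \<union> (\<Union>j\<in>S - {i}. N j)" by auto
        moreover have "card S = Suc (card (S - {i}))"
          using True S \<open>finite X\<close> by (metis card_Suc_Diff1 finite_subset)
        moreover have "S - {i} \<subseteq> X - {i}" using S by blast
        ultimately show ?thesis using ok by metis
      next
        case False
        then have "(\<Union>j\<in>S. ?N j) = (\<Union>j\<in>S. N j)" by auto
        then show ?thesis using rado S by metis
      qed
      ultimately have "\<exists>f. (\<forall>j\<in>X. f j \<in> ?N j) \<and> inj_on f X \<and> f ` X \<in> \<I>"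
        using fin by (intro less.hyps) auto
      then obtain f where f: "\<forall>j\<in>X. f j \<in> ?N j" "inj_on f X" "f ` X \<in> \<I>" by blast
      have "?N j \<subseteq> N j" for j by auto
      then show ?thesis using f by blast
    qed
    show ?thesis
    proof (rule ccontr)
      assume neg: "\<nexists>f. (\<forall>i\<in>X. f i \<in> N i) \<and> inj_on f X \<and> f ` X \<in> \<I>"
      \<comment> \<open>If neither deletion is allowed, \<open>S\<close> and \<open>T\<close>
        witness the failures. As \<open>a\<close> and \<open>b\<close> differ,
        \<open>?A \<union> ?B\<close> contains all of \<open>N i\<close>, and
        \<open>?A \<inter> ?B\<close> contains the sets indexed by \<open>S \<inter> T\<close>. The
        rank condition for \<open>insert i (S \<union> T)\<close> and \<open>S \<inter> T\<close>
        then exceeds the submodular bound by one.\<close>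
      obtain S where S: "S \<subseteq> X - {i}"
        "matroid_rank \<I> ((N i - {a}) \<union> (\<Union>j\<in>S. N j)) \<le> card S" (is "matroid_rank _ ?A \<le> _")
        using step[of a] neg iab by (meson not_less_eq_eq)
      obtain T where T: "T \<subseteq> X - {i}"
        "matroid_rank \<I> ((N i - {b}) \<union> (\<Union>j\<in>T. N j)) \<le> card T" (is "matroid_rank _ ?B \<le> _")
        using step[of b] neg iab by (meson not_less_eq_eq)
      have fST: "finite S" "finite T" using S T \<open>finite X\<close> finite_subset by blast+
      have "card (S \<union> T) + 1 = card (insert i (S \<union> T))"
        using fST S T by (subst card_insert_disjoint) auto
      also have "\<dots> \<le> matroid_rank \<I> (\<Union>j\<in>insert i (S \<union> T). N j)"
        using S T iab by (intro rado) auto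
      also have "\<dots> \<le> matroid_rank \<I> (?A \<union> ?B)"
        using iab by (intro matroid_rank_mono[OF M]) auto
      finally have 1: "card (S \<union> T) + 1 \<le> matroid_rank \<I> (?A \<union> ?B)" .
      have "card (S \<inter> T) \<le> matroid_rank \<I> (\<Union>j\<in>S \<inter> T. N j)"
        using S by (intro rado) auto
      also have "\<dots> \<le> matroid_rank \<I> (?A \<inter> ?B)"
        by (intro matroid_rank_mono[OF M]) auto
      finally have 2: "card (S \<inter> T) \<le> matroid_rank \<I> (?A \<inter> ?B)" .
      show False
        using 1 2 matroid_rank_submodular[OF M, of ?A ?B] S(2) T(2) card_Un_Int[OF fST] by linarith
    qed
  qed
qed

section \<open>A partition with equal masses\<close>

text \<open>Links limits in the function space, where compactness and \<open>dist\<close> live, to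
  the pointwise limits in \<open>closed_preferences\<close>.\<close>

lemma tendsto_coordinatewise:
  fixes X :: "'c \<Rightarrow> 'i \<Rightarrow> 'b::topological_space"
  shows "(X \<longlongrightarrow> x) F \<longleftrightarrow> (\<forall>i. ((\<lambda>m. X m i) \<longlongrightarrow> x i) F)"
  using limitin_componentwise[where I = UNIV and X = "\<lambda>_. euclidean"]
  by (simp add: euclidean_product_topology)

text \<open>Tychonoff: coordinates from \<open>d\<close> on are confined to a point, so this is a
  copy of the \<open>d\<close>-dimensional cube.\<close>

lemma compact_unit_cube:
  "compact {u :: nat \<Rightarrow> real. (\<forall>i. 0 \<le> u i \<and> u i \<le> 1) \<and> (\<forall>i\<ge>d. u i = 1)}"
proof -
  have "compact (PiE UNIV (\<lambda>i::nat. if i < d then {0..1} else {1::real}))"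
    using compactin_PiE[of "\<lambda>_. euclidean" UNIV "\<lambda>i::nat. if i < d then {0..1} else {1::real}"]
    by (auto simp: euclidean_product_topology)
  moreover have "PiE UNIV (\<lambda>i::nat. if i < d then {0..1} else {1::real}) =
    {u. (\<forall>i. 0 \<le> u i \<and> u i \<le> 1) \<and> (\<forall>i\<ge>d. u i = 1)}"
  proof (rule set_eqI)
    fix u :: "nat \<Rightarrow> real"
    have "u i \<in> (if i < d then {0..1} else {1}) \<longleftrightarrow> 0 \<le> u i \<and> u i \<le> 1 \<and> (d \<le> i \<longrightarrow> u i = 1)" for i
      by auto
    then show "u \<in> PiE UNIV (\<lambda>i. if i < d then {0..1} else {1}) \<longleftrightarrow>
        u \<in> {u. (\<forall>i. 0 \<le> u i \<and> u i \<le> 1) \<and> (\<forall>i\<ge>d. u i = 1)}"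
      by (simp add: PiE_iff) blast
  qed
  ultimately show ?thesis by simp
qed

text \<open>Kuhn's combinatorial lemma, applied to signs of \<open>g\<close> on ever finer grids,
  yields cells in which every \<open>g i\<close> takes both signs at corners. A limit point of these
  cells is a common zero by continuity.\<close>

theorem poincare_miranda_cube:
  fixes g :: "nat \<Rightarrow> (nat \<Rightarrow> real) \<Rightarrow> real"
  defines "C \<equiv> \<lambda>d. {u :: nat \<Rightarrow> real. (\<forall>i. 0 \<le> u i \<and> u i \<le> 1) \<and> (\<forall>i\<ge>d. u i = 1)}"
  assumes cont: "\<And>i. i < d \<Longrightarrow> continuous_on (C d) (g i)"
    and low: "\<And>i u. i < d \<Longrightarrow> u \<in> C d \<Longrightarrow> u i = 0 \<Longrightarrow> g i u \<le> 0"
    and high: "\<And>i u. i < d \<Longrightarrow> u \<in> C d \<Longrightarrow> u i = 1 \<Longrightarrow> 0 \<le> g i u"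
  shows "\<exists>u\<in>C d. \<forall>i<d. g i u = 0"
proof -
  define pt where "pt m x = (\<lambda>i. if i < d then real (x i) / real (Suc m) else 1)"
    for m :: nat and x :: "nat \<Rightarrow> nat"
  have ptC: "pt m x \<in> C d" if "\<forall>i<d. x i \<le> Suc m" for m x
    using that by (auto simp: pt_def C_def divide_le_eq_1 simp del: of_nat_Suc)
  have "\<exists>q. (\<forall>i<d. q i < Suc m) \<and> (\<forall>i<d. \<exists>r s.
      (\<forall>j<d. q j \<le> r j \<and> r j \<le> q j + 1) \<and> (\<forall>j<d. q j \<le> s j \<and> s j \<le> q j + 1) \<and>
      g i (pt m r) \<le> 0 \<and> 0 \<le> g i (pt m s))" for m
  proof -
    \<comment> \<open>The labels on the boundary are those that \<open>kuhn_lemma\<close> demands;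
      \<open>low\<close> and \<open>high\<close> make them agree with the sign of \<open>g i\<close>
      even where \<open>g i\<close> vanishes.\<close>
    define lab where "lab x i = (if x i = 0 then 0 else if x i = Suc m then 1
       else if g i (pt m x) \<le> 0 then 0 else (1::nat))" for x i
    obtain q where q: "\<forall>i<d. q i < Suc m" "\<forall>i<d. \<exists>r s. (\<forall>j<d. q j \<le> r j \<and> r j \<le> q j + 1) \<and>
        (\<forall>j<d. q j \<le> s j \<and> s j \<le> q j + 1) \<and> lab r i \<noteq> lab s i"
      by (rule kuhn_lemma[of "Suc m" d lab]) (auto simp: lab_def)
    have sgn: "(lab x i = 0 \<longrightarrow> g i (pt m x) \<le> 0) \<and> (lab x i \<noteq> 0 \<longrightarrow> 0 \<le> g i (pt m x))"
      if "i < d" "\<forall>j<d. q j \<le> x j \<and> x j \<le> q j + 1" for x i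
    proof -
      have "\<forall>j<d. x j \<le> Suc m" using that q(1) by fastforce
      then have "pt m x \<in> C d" using ptC by blast
      then show ?thesis
        using low[OF that(1), of "pt m x"] high[OF that(1), of "pt m x"] that(1)
        by (auto simp: lab_def pt_def simp del: of_nat_Suc)
    qed
    have "\<exists>r s. (\<forall>j<d. q j \<le> r j \<and> r j \<le> q j + 1) \<and> (\<forall>j<d. q j \<le> s j \<and> s j \<le> q j + 1) \<and>
      g i (pt m r) \<le> 0 \<and> 0 \<le> g i (pt m s)" if "i < d" for i
    proof -
      obtain r s where rs: "\<forall>j<d. q j \<le> r j \<and> r j \<le> q j + 1" "\<forall>j<d. q j \<le> s j \<and> s j \<le> q j + 1"
        "lab r i \<noteq> lab s i" using q(2) \<open>i < d\<close> by blast
      show ?thesis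
      proof (cases "lab r i = 0")
        case True
        then have "lab s i \<noteq> 0" using rs by simp
        then show ?thesis using True sgn[OF that rs(1)] sgn[OF that rs(2)] rs by blast
      next
        case False
        then have "lab s i = 0" using rs by (auto simp: lab_def split: if_splits)
        then show ?thesis using False sgn[OF that rs(1)] sgn[OF that rs(2)] rs by blast
      qed
    qed
    then show ?thesis using q(1) by blast
  qed
  then obtain q where q: "\<And>m i. i < d \<Longrightarrow> q m i < Suc m"
    and ex: "\<And>m i. i < d \<Longrightarrow> \<exists>r s. (\<forall>j<d. q m j \<le> r j \<and> r j \<le> q m j + 1) \<and>
      (\<forall>j<d. q m j \<le> s j \<and> s j \<le> q m j + 1) \<and> g i (pt m r) \<le> 0 \<and> 0 \<le> g i (pt m s)"
    by metis
  define near where "near m x \<longleftrightarrow> (\<forall>j<d. q m j \<le> x j \<and> x j \<le> q m j + 1)" for m x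
  have "\<forall>m i. \<exists>r s. i < d \<longrightarrow> near m r \<and> near m s \<and> g i (pt m r) \<le> 0 \<and> 0 \<le> g i (pt m s)"
    using ex by (simp add: near_def)
  then obtain r s where "\<forall>m i. i < d \<longrightarrow> near m (r m i) \<and> near m (s m i) \<and>
      g i (pt m (r m i)) \<le> 0 \<and> 0 \<le> g i (pt m (s m i))"
    by metis
  then have r: "\<And>m i. i < d \<Longrightarrow> near m (r m i)" and s: "\<And>m i. i < d \<Longrightarrow> near m (s m i)"
    and gr: "\<And>m i. i < d \<Longrightarrow> g i (pt m (r m i)) \<le> 0" and gs: "\<And>m i. i < d \<Longrightarrow> 0 \<le> g i (pt m (s m i))"
    by blast+
  have compact: "compact (C d)"
    unfolding C_def by (rule compact_unit_cube)
  have "\<forall>m. pt m (q m) \<in> C d"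
    using q by (intro allI ptC impI less_imp_le)
  then obtain u h where u: "u \<in> C d" "strict_mono h" "((\<lambda>m. pt m (q m)) \<circ> h) \<longlonglongrightarrow> u"
    by (rule seq_compactE[OF compact_imp_seq_compact[OF compact]])
  \<comment> \<open>Any corner of a cell is within one mesh width of the base corner
    \<open>q\<close> in each coordinate, so every choice of corners along \<open>h\<close> has the
    same limit \<open>u\<close>.\<close>
  have lim_near: "(\<lambda>m. pt (h m) (t (h m))) \<longlonglongrightarrow> u \<and> (\<forall>m. pt (h m) (t (h m)) \<in> C d)"
    if t: "\<And>m. near m (t m)" for t
  proof
    have inv: "(\<lambda>m. 1 / real (Suc (h m))) \<longlonglongrightarrow> 0"
      using LIMSEQ_subseq_LIMSEQ[OF lim_inverse_n' [THEN LIMSEQ_Suc] u(2)] by (simp add: o_def)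
    show "(\<lambda>m. pt (h m) (t (h m))) \<longlonglongrightarrow> u"
      unfolding tendsto_coordinatewise
    proof
      fix j
      have a: "(\<lambda>m. pt (h m) (q (h m)) j) \<longlonglongrightarrow> u j"
        using u(3) unfolding tendsto_coordinatewise by (simp add: o_def)
      have b: "(\<lambda>m. pt (h m) (q (h m)) j + 1 / real (Suc (h m))) \<longlonglongrightarrow> u j"
        using tendsto_add[OF a inv] by simp
      have le: "pt m (q m) j \<le> pt m (t m) j \<and> pt m (t m) j \<le> pt m (q m) j + 1 / real (Suc m)" for m
      proof (cases "j < d")
        case True
        then have "real (q m j) \<le> real (t m j)" "real (t m j) \<le> real (q m j) + 1"
          using t[of m] True by (auto simp: near_def)
        then show ?thesis using True
          by (simp add: pt_def divide_right_mono add_divide_distrib[symmetric] del: of_nat_Suc)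
      qed (simp add: pt_def)
      show "(\<lambda>m. pt (h m) (t (h m)) j) \<longlonglongrightarrow> u j"
        by (rule tendsto_sandwich[OF _ _ a b]) (use le in auto)
    qed
    have "\<forall>j<d. t m j \<le> Suc m" for m
      using t[of m] q[of _ m]
      unfolding near_def Suc_eq_plus1[symmetric] by (meson Suc_leI le_trans)
    then show "\<forall>m. pt (h m) (t (h m)) \<in> C d"
      using ptC by blast
  qed
  have "g i u = 0" if i: "i < d" for i
  proof (rule antisym)
    have lim: "(\<lambda>m. g i (pt (h m) (t (h m)))) \<longlonglongrightarrow> g i u"
      if t: "\<And>m. near m (t m)" for t
      using lim_near[of t, OF t]
      by (intro continuous_on_tendsto_compose[OF cont[OF i] _ u(1)]) auto
    show "g i u \<le> 0"
      by (rule LIMSEQ_le_const2[OF lim[of "\<lambda>m. r m i"]]) (use r gr i in auto)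
    show "0 \<le> g i u"
      by (rule LIMSEQ_le_const[OF lim[of "\<lambda>m. s m i"]]) (use s gs i in auto)
  qed
  then show ?thesis using u(1) by (intro bexI[of _ u]) auto
qed

text \<open>
  Running maxima map the cube onto the partitions so that \<open>u i = 0\<close> makes piece \<open>i + 1\<close> empty, while
  \<open>u i = 1\<close> makes all pieces after it empty.
\<close>

primrec cuts :: "(nat \<Rightarrow> real) \<Rightarrow> nat \<Rightarrow> real" where
  "cuts u 0 = 0"
| "cuts u (Suc i) = max (cuts u i) (u i)"

lemma mono_cuts: "mono (cuts u)"
  by (simp add: mono_iff_le_Suc)

lemma continuous_on_cuts: "continuous_on S cuts"
proof (rule continuous_on_coordinatewise_then_product)
  fix i show "continuous_on S (\<lambda>u. cuts u i)"
    by (induction i) (auto intro!: continuous_intros continuous_on_subset[OF continuous_on_product_coordinates])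
qed

lemma cuts_le_1: "(\<And>i. u i \<le> 1) \<Longrightarrow> cuts u i \<le> 1"
  by (induction i) auto

lemma cuts_eq_1:
  assumes "\<And>i. u i \<le> 1" "u i = 1" "i < l"
  shows "cuts u l = 1"
proof -
  have "1 \<le> cuts u (Suc i)" using assms(2) by simp
  also have "\<dots> \<le> cuts u l" using assms(3) by (intro monoD[OF mono_cuts]) simp
  finally show ?thesis using cuts_le_1[of u l] assms(1) by simp
qed

text \<open>Each value is the average of the later ones, so downward induction from \<open>k\<close>
  makes them all equal to the last.\<close>

lemma tail_averages_imp_equal:
  fixes a :: "nat \<Rightarrow> real"
  assumes "1 \<le> k" "\<And>i. 1 \<le> i \<Longrightarrow> i < k \<Longrightarrow> real (k - i) * a i = (\<Sum>l=Suc i..k. a l)"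
    and "i \<in> {1..k}"
  shows "a i = a k"
proof -
  have "i \<le> k \<Longrightarrow> 1 \<le> i \<Longrightarrow> a i = a k"
  proof (induction "k - i" arbitrary: i rule: less_induct)
    case less
    show ?case
    proof (cases "i = k")
      case False
      have "(\<Sum>l=Suc i..k. a l) = (\<Sum>l=Suc i..k. a k)"
        using less.prems False by (intro sum.cong refl less.hyps) auto
      then have "real (k - i) * a i = real (k - i) * a k"
        using assms(2)[of i] less.prems(1,2) False by simp
      then show ?thesis using less.prems(1) False by simp
    qed simp
  qed
  then show ?thesis using assms(3) by simp
qed

text \<open>The masses are pulled back along \<open>cuts\<close> to a cube. A common zero of the
  functions \<open>g i\<close> makes each mass the average of the later ones, hence all are equal,
  and the total \<open>k\<close> fixes the value 1.\<close>

theorem equal_masses: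
  fixes m :: "nat \<Rightarrow> (nat \<Rightarrow> real) \<Rightarrow> real"
  assumes k: "1 \<le> k"
    and cont: "\<And>i. i \<in> {1..k} \<Longrightarrow> continuous_on (cake_partitions k) (m i)"
    and nonneg: "\<And>i x. i \<in> {1..k} \<Longrightarrow> x \<in> cake_partitions k \<Longrightarrow> 0 \<le> m i x"
    and face: "\<And>i x. i \<in> {1..k} \<Longrightarrow> x \<in> cake_partitions k \<Longrightarrow> piece_length x i = 0 \<Longrightarrow> m i x = 0"
    and total: "\<And>x. x \<in> cake_partitions k \<Longrightarrow> (\<Sum>i=1..k. m i x) = real k"
  shows "\<exists>x\<in>cake_partitions k. \<forall>i\<in>{1..k}. m i x = 1"
proof -
  \<comment> \<open>There are \<open>k - 1\<close> free interior cuts; fixing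
    \<open>u (k - 1) = 1\<close> makes cut number \<open>k\<close> equal to 1.\<close>
  let ?C = "{u :: nat \<Rightarrow> real. (\<forall>i. 0 \<le> u i \<and> u i \<le> 1) \<and> (\<forall>i\<ge>k - 1. u i = 1)}"
  have K: "cuts u \<in> cake_partitions k" if "u \<in> ?C" for u
    using that k cuts_eq_1[of u "k - 1"] by (auto simp: cake_partitions_def mono_cuts)
  \<comment> \<open>\<open>g i\<close> compares the mass of piece \<open>i + 1\<close> with the average mass of the later pieces.\<close>
  define g where "g i u = real (k - Suc i) * m (Suc i) (cuts u) - (\<Sum>l=Suc (Suc i)..k. m l (cuts u))" for i u
  have "\<exists>u\<in>?C. \<forall>i<k-1. g i u = 0"
  proof (rule poincare_miranda_cube)
    fix i assume i: "i < k - 1"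
    have "continuous_on ?C (\<lambda>u. m l (cuts u))" if "l \<in> {1..k}" for l
      using K by (intro continuous_on_compose2[OF cont[OF that] continuous_on_cuts]) auto
    then show "continuous_on ?C (g i)"
      unfolding g_def using i by (intro continuous_intros) auto
    fix u assume u: "u \<in> ?C"
    { assume "u i = 0"
      moreover have "cuts u 0 \<le> cuts u i" by (intro monoD[OF mono_cuts]) simp
      ultimately have "piece_length (cuts u) (Suc i) = 0" by (simp add: piece_length_def)
      then have "m (Suc i) (cuts u) = 0" using face[OF _ K[OF u]] i by simp
      then show "g i u \<le> 0"
        using nonneg[OF _ K[OF u]] by (auto simp: g_def intro!: sum_nonneg) }
    { assume "u i = 1"
      then have "cuts u l = 1" if "i < l" for l using cuts_eq_1 u that by blast
      then have "m l (cuts u) = 0" if "l \<in> {Suc (Suc i)..k}" for l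
        using face[OF _ K[OF u], of l] that by (auto simp: piece_length_def)
      then show "0 \<le> g i u"
        using nonneg[OF _ K[OF u], of "Suc i"] i by (simp add: g_def) }
  qed
  then obtain u where u: "u \<in> ?C" "\<And>i. i < k - 1 \<Longrightarrow> g i u = 0" by blast
  have eq: "m i (cuts u) = m k (cuts u)" if "i \<in> {1..k}" for i
  proof (rule tail_averages_imp_equal[OF k _ that])
    fix i assume "1 \<le> i" "i < k"
    then show "real (k - i) * m i (cuts u) = (\<Sum>l=Suc i..k. m l (cuts u))"
      using u(2)[of "i - 1"] by (simp add: g_def)
  qed
  have "(\<Sum>i=1..k. m i (cuts u)) = (\<Sum>i=1..k. m k (cuts u))"
    by (intro sum.cong refl eq)
  then have "real k * m k (cuts u) = real k"
    using total[OF K[OF u(1)]] by simp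
  then have "m k (cuts u) = 1" using k by simp
  then show ?thesis using eq K[OF u(1)] by (intro bexI[of _ "cuts u"]) auto
qed

section \<open>Envy-free allocation to a basis\<close>

lemma compact_cake_partitions: "compact (cake_partitions k)"
proof -
  let ?C = "{u :: nat \<Rightarrow> real. (\<forall>i. 0 \<le> u i \<and> u i \<le> 1) \<and> (\<forall>i\<ge>k. u i = 1)}"
  have cont: "continuous_on UNIV (\<lambda>x::nat \<Rightarrow> real. x i)" for i
    by (rule continuous_on_product_coordinates)
  have "closed ({x::nat \<Rightarrow> real. x 0 = 0} \<inter> {x. \<forall>i. x i \<le> x (Suc i)})"
    by (intro closed_Int closed_Collect_all closed_Collect_eq closed_Collect_le cont continuous_on_const)
  then have "compact (?C \<inter> ({x. x 0 = 0} \<inter> {x. \<forall>i. x i \<le> x (Suc i)}))"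
    by (intro compact_Int_closed compact_unit_cube)
  moreover have "cake_partitions k = ?C \<inter> ({x. x 0 = 0} \<inter> {x. \<forall>i. x i \<le> x (Suc i)})"
  proof -
    have "0 \<le> x i \<and> x i \<le> 1" if "x \<in> cake_partitions k" for x i
    proof -
      have "mono x" using that by (simp add: cake_partitions_def)
      \<comment> \<open>The index \<open>max i k\<close> is at least \<open>k\<close>, where every
        cut is 1.\<close>
      then have "x 0 \<le> x i" "x i \<le> x (max i k)" by (simp_all add: monoD)
      then show ?thesis using that by (simp add: cake_partitions_def)
    qed
    then show ?thesis
      by (auto simp: cake_partitions_def mono_iff_le_Suc)
  qed
  ultimately show ?thesis by simp
qed

lemma piece_length_nonneg: "x \<in> cake_partitions k \<Longrightarrow> 0 \<le> piece_length x i"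
  by (auto simp: cake_partitions_def piece_length_def intro: monoD)

lemma continuous_on_piece_length: "continuous_on S (\<lambda>x. piece_length x i)"
  unfolding piece_length_def
  by (intro continuous_intros continuous_on_subset[OF continuous_on_product_coordinates]) auto

lemma infdist_lessE:
  assumes "infdist x A < d" "A \<noteq> {}"
  obtains y where "y \<in> A" "dist x y < d"
proof (rule ccontr)
  assume "\<not> thesis"
  then have "d \<le> infdist x A"
    unfolding infdist_notempty[OF assms(2)] using that assms(2)
    by (intro cINF_greatest) (auto simp: not_less[symmetric])
  then show False using assms(1) by simp
qed

lemma sum_card_fibres:
  assumes "finite B" "finite S"
  shows "(\<Sum>i\<in>S. card {j \<in> B. \<sigma> j = i}) = card {j \<in> B. \<sigma> j \<in> S}"
proof -
  have "{j \<in> B. \<sigma> j \<in> S} = (\<Union>i\<in>S. {j \<in> B. \<sigma> j = i})" by auto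
  then show ?thesis
    using assms by (simp add: card_UN_disjoint disjoint_iff)
qed

text \<open>Hungriness is applied to the guests outside \<open>H\<close>, none of whom prefers a
  piece of positive length; so \<open>H\<close> must have full rank. The map is extensional so that
  only finitely many pairs arise later.\<close>

lemma hungry_basis:
  assumes M: "matroid E \<I>" and rank: "matroid_rank \<I> E = k" and k: "1 \<le> k"
    and hungry: "matroid_hungry k E \<I> P" and x: "x \<in> cake_partitions k"
  obtains B \<sigma> where "matroid_basis E \<I> B" "\<sigma> \<in> B \<rightarrow>\<^sub>E {1..k}"
    "\<And>j. j \<in> B \<Longrightarrow> \<sigma> j \<in> P j x \<and> 0 < piece_length x (\<sigma> j)"
proof -
  define H where "H = {j \<in> E. \<exists>i\<in>{1..k}. i \<in> P j x \<and> 0 < piece_length x i}"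
  have "E - (E - H) = H" by (auto simp: H_def)
  then have "\<not> matroid_rank \<I> H \<le> k - 1"
    using hungry x unfolding matroid_hungry_def H_def
    by (smt (verit) Diff_iff Diff_subset mem_Collect_eq)
  moreover have "matroid_rank \<I> H \<le> k"
    using matroid_rank_mono[OF M, of H E] rank by (auto simp: H_def)
  ultimately have rH: "matroid_rank \<I> H = k" by simp
  obtain B where B: "B \<in> \<I>" "B \<subseteq> H" "card B = k"
    using matroid_rank_attained[OF M, of H] rH by metis
  have "\<forall>j\<in>B. \<exists>i. i \<in> {1..k} \<and> i \<in> P j x \<and> 0 < piece_length x i"
    using B(2) unfolding H_def by blast
  then obtain s where s: "\<forall>j\<in>B. s j \<in> {1..k} \<and> s j \<in> P j x \<and> 0 < piece_length x (s j)"
    by metis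
  show ?thesis
    by (rule that[of B "restrict s B"]) (use B s rank in \<open>auto simp: matroid_basis_def\<close>)
qed

text \<open>The slack \<open>\<delta>\<close> pays for continuity: a weight may be positive near,
  not only on, the set where a pair fits exactly. The witness \<open>y\<close> may depend on the
  piece.\<close>

lemma approximate_envy_free:
  assumes M: "matroid E \<I>" and rank: "matroid_rank \<I> E = k" and k: "1 \<le> k"
    and hungry: "matroid_hungry k E \<I> P" and \<delta>: "0 < \<delta>"
  shows "\<exists>f. \<exists>x\<in>cake_partitions k. inj_on f {1..k} \<and> f ` {1..k} \<in> \<I> \<and>
    (\<forall>i\<in>{1..k}. f i \<in> E \<and> (\<exists>y\<in>cake_partitions k. dist x y < \<delta> \<and> i \<in> P (f i) y))"
proof -
  define K where "K = cake_partitions k"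
  define T where "T = (SIGMA B:{B. matroid_basis E \<I> B}. B \<rightarrow>\<^sub>E {1..k})"
  define A where "A = (\<lambda>(B, \<sigma>). {y \<in> K. \<forall>j\<in>B. \<sigma> j \<in> P j y})"
  \<comment> \<open>The product keeps the support off the faces; \<open>infdist\<close> to the empty set is \<open>0\<close>, hence the case split.\<close>
  define \<phi> where "\<phi> \<tau> x = (if A \<tau> = {} then 0 else max 0 (\<delta> - infdist x (A \<tau>))) *
      (\<Prod>j\<in>fst \<tau>. piece_length x (snd \<tau> j))" for \<tau> x
  define \<Phi> where "\<Phi> x = (\<Sum>\<tau>\<in>T. \<phi> \<tau> x)" for x
  define hits where "hits \<tau> S = card {j \<in> fst \<tau>. snd \<tau> j \<in> S}" for \<tau> :: "'a set \<times> ('a \<Rightarrow> nat)" and S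
  define m where "m i x = (\<Sum>\<tau>\<in>T. \<phi> \<tau> x / \<Phi> x * hits \<tau> {i})" for i x
  have E: "finite E" "\<And>I. I \<in> \<I> \<Longrightarrow> I \<subseteq> E" using M by (auto simp: matroid_def)
  have base: "fst \<tau> \<in> \<I>" "card (fst \<tau>) = k" "finite (fst \<tau>)" if "\<tau> \<in> T" for \<tau>
    using that rank matroid_independent_finite[OF M] by (auto simp: T_def matroid_basis_def)
  have finT: "finite T"
    unfolding T_def
  proof (rule finite_SigmaI)
    show "finite {B. matroid_basis E \<I> B}"
      by (rule finite_subset[of _ "Pow E"]) (use E in \<open>auto simp: matroid_basis_def\<close>)
    show "finite (B \<rightarrow>\<^sub>E {1..k})" if "B \<in> {B. matroid_basis E \<I> B}" for B
      using that matroid_independent_finite[OF M] by (intro finite_PiE) (auto simp: matroid_basis_def)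
  qed
  have \<phi>_cont: "continuous_on K (\<phi> \<tau>)" for \<tau>
    unfolding \<phi>_def
    by (cases "A \<tau> = {}") (auto intro!: continuous_intros continuous_on_piece_length)
  have \<phi>_nonneg: "0 \<le> \<phi> \<tau> x" if "x \<in> K" for \<tau> x
    using piece_length_nonneg[of x k] that by (auto simp: \<phi>_def K_def intro!: mult_nonneg_nonneg prod_nonneg)
  \<comment> \<open>The pair given by \<open>hungry_basis\<close> at \<open>x\<close> has distance 0
    to its set \<open>A\<close> and a positive product, so its weight is positive.\<close>
  have \<Phi>_pos: "0 < \<Phi> x" if x: "x \<in> K" for x
  proof -
    obtain B \<sigma> where B: "matroid_basis E \<I> B" "\<sigma> \<in> B \<rightarrow>\<^sub>E {1..k}"
      "\<And>j. j \<in> B \<Longrightarrow> \<sigma> j \<in> P j x \<and> 0 < piece_length x (\<sigma> j)"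
      using hungry_basis[OF M rank k hungry] x unfolding K_def by metis
    have "x \<in> A (B, \<sigma>)" using B x by (simp add: A_def)
    then have "0 < \<phi> (B, \<sigma>) x"
      using B(3) \<delta> by (auto simp: \<phi>_def intro!: mult_pos_pos prod_pos)
    moreover have "(B, \<sigma>) \<in> T" using B by (simp add: T_def)
    ultimately show ?thesis
      unfolding \<Phi>_def using finT \<phi>_nonneg[OF x] by (intro sum_pos2[of _ "(B, \<sigma>)"]) auto
  qed
  have hits_sum: "(\<Sum>i\<in>S. hits \<tau> {i}) = hits \<tau> S" if "finite S" "\<tau> \<in> T" for S \<tau>
    using sum_card_fibres[OF base(3) that(1)] that by (simp add: hits_def)
  have m_sum: "(\<Sum>i\<in>S. m i x) = (\<Sum>\<tau>\<in>T. \<phi> \<tau> x / \<Phi> x * hits \<tau> S)" if "finite S" for S x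
  proof -
    have "(\<Sum>i\<in>S. m i x) = (\<Sum>\<tau>\<in>T. \<Sum>i\<in>S. \<phi> \<tau> x / \<Phi> x * hits \<tau> {i})"
      unfolding m_def by (rule sum.swap)
    also have "\<dots> = (\<Sum>\<tau>\<in>T. \<phi> \<tau> x / \<Phi> x * hits \<tau> S)"
      by (intro sum.cong refl) (simp only: sum_distrib_left[symmetric] of_nat_sum[symmetric] hits_sum[OF that])
    finally show ?thesis .
  qed
  have weights: "(\<Sum>\<tau>\<in>T. \<phi> \<tau> x / \<Phi> x * c) = c" if "x \<in> K" for x c
    using \<Phi>_pos[OF that] by (simp add: sum_distrib_right[symmetric] sum_divide_distrib[symmetric] flip: \<Phi>_def)
  have "\<exists>x\<in>cake_partitions k. \<forall>i\<in>{1..k}. m i x = 1"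
  proof (rule equal_masses[OF k], unfold K_def[symmetric])
    have "\<forall>x\<in>K. \<Phi> x \<noteq> 0" using \<Phi>_pos by force
    moreover have "continuous_on K \<Phi>"
      unfolding \<Phi>_def by (intro continuous_on_sum \<phi>_cont)
    ultimately show "continuous_on K (m i)" for i
      unfolding m_def by (intro continuous_intros \<phi>_cont) auto
    fix x assume x: "x \<in> K"
    show "0 \<le> m i x" for i
      using \<phi>_nonneg[OF x] \<Phi>_pos[OF x] by (auto simp: m_def intro!: sum_nonneg)
    \<comment> \<open>A pair that sends a guest to the empty piece has a vanishing factor in its
      weight; any other pair has no hits there.\<close>
    show "m i x = 0" if i: "piece_length x i = 0" for i
      unfolding m_def
    proof (rule sum.neutral, rule ballI)
      fix \<tau> assume \<tau>: "\<tau> \<in> T"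
      show "\<phi> \<tau> x / \<Phi> x * hits \<tau> {i} = 0"
      proof (cases "\<exists>j\<in>fst \<tau>. snd \<tau> j = i")
        case True
        then have "\<phi> \<tau> x = 0" using i base(3)[OF \<tau>] by (auto simp: \<phi>_def)
        then show ?thesis by simp
      next
        case False
        then have "{j \<in> fst \<tau>. snd \<tau> j \<in> {i}} = {}" by auto
        then have "hits \<tau> {i} = 0" unfolding hits_def by (metis card.empty)
        then show ?thesis by simp
      qed
    qed
    have "hits \<tau> {1..k} = k" if "\<tau> \<in> T" for \<tau>
    proof -
      have "{j \<in> fst \<tau>. snd \<tau> j \<in> {1..k}} = fst \<tau>" using that by (auto simp: T_def PiE_iff)
      then show ?thesis using base(2)[OF that] by (simp add: hits_def)
    qed
    then show "(\<Sum>i=1..k. m i x) = real k"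
      using weights[OF x, of "real k"] by (simp add: m_sum)
  qed
  then obtain x where x: "x \<in> K" "\<And>i. i \<in> {1..k} \<Longrightarrow> m i x = 1" unfolding K_def by blast
  \<comment> \<open>Rado's theorem is indexed by pieces: the transversal picks one acceptable guest
    for each piece.\<close>
  define N where "N i = {j \<in> E. \<exists>y\<in>K. dist x y < \<delta> \<and> i \<in> P j y}" for i
  have "\<exists>f. (\<forall>i\<in>{1..k}. f i \<in> N i) \<and> inj_on f {1..k} \<and> f ` {1..k} \<in> \<I>"
  proof (rule rado_independent_transversal[OF M])
    show "finite (N i)" for i using E(1) by (simp add: N_def)
    fix S :: "nat set" assume S: "S \<subseteq> {1..k}"
    then have finS: "finite S" by (rule finite_subset) simp
    let ?r = "matroid_rank \<I> (\<Union>i\<in>S. N i)"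
    \<comment> \<open>A nonzero weight puts a point of \<open>A \<tau>\<close> within
      \<open>\<delta>\<close> of \<open>x\<close>, so the guests that \<open>\<tau>\<close> sends
      into \<open>S\<close> form an independent subset of the union of the
      \<open>N i\<close>.\<close>
    have le: "\<phi> \<tau> x / \<Phi> x * hits \<tau> S \<le> \<phi> \<tau> x / \<Phi> x * ?r" if \<tau>: "\<tau> \<in> T" for \<tau>
    proof (cases "\<phi> \<tau> x = 0")
      case False
      then have "A \<tau> \<noteq> {}" "infdist x (A \<tau>) < \<delta>"
        by (auto simp: \<phi>_def split: if_splits)
      then obtain y where y: "y \<in> A \<tau>" "dist x y < \<delta>" using infdist_lessE by blast
      have "{j \<in> fst \<tau>. snd \<tau> j \<in> S} \<subseteq> (\<Union>i\<in>S. N i)"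
        using y E(2)[OF base(1)[OF \<tau>]] by (auto simp: A_def N_def split: prod.splits)
      moreover have "{j \<in> fst \<tau>. snd \<tau> j \<in> S} \<in> \<I>"
        by (rule matroid_independent_subset[OF M base(1)[OF \<tau>]]) auto
      ultimately have "hits \<tau> S \<le> ?r"
        unfolding hits_def by (intro matroid_rank_ge_card[OF M])
      then show ?thesis
        using \<phi>_nonneg[OF x(1), of \<tau>] \<Phi>_pos[OF x(1)] by (intro mult_left_mono) auto
    qed simp
    have "real (card S) = (\<Sum>i\<in>S. m i x)"
      using x(2) S by (simp add: subset_iff)
    also have "\<dots> = (\<Sum>\<tau>\<in>T. \<phi> \<tau> x / \<Phi> x * hits \<tau> S)" by (rule m_sum[OF finS])
    also have "\<dots> \<le> (\<Sum>\<tau>\<in>T. \<phi> \<tau> x / \<Phi> x * ?r)" by (intro sum_mono le)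
    also have "\<dots> = real ?r" by (rule weights[OF x(1)])
    finally show "card S \<le> ?r" by simp
  qed simp
  then obtain f where f: "\<forall>i\<in>{1..k}. f i \<in> N i" "inj_on f {1..k}" "f ` {1..k} \<in> \<I>" by blast
  then have "\<forall>i\<in>{1..k}. f i \<in> E \<and> (\<exists>y\<in>cake_partitions k. dist x y < \<delta> \<and> i \<in> P (f i) y)"
    by (simp add: N_def K_def)
  moreover have "x \<in> cake_partitions k" using x(1) by (simp add: K_def)
  ultimately show ?thesis using f(2,3) by (intro exI[of _ f] bexI[of _ x] conjI)
qed

section \<open>Limit of the approximate allocations\<close>

theorem theorem3p3:
  fixes n k :: nat
    and \<I> :: "nat set set"
    and P :: "nat \<Rightarrow> (nat \<Rightarrow> real) \<Rightarrow> nat set"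
  assumes "matroid {1..n} \<I>"
    and "matroid_rank \<I> {1..n} = k"
    and "1 \<le> k" and "k \<le> n"
    and "preferences k {1..n} P"
    and "closed_preferences k {1..n} P"
    and "matroid_hungry k {1..n} \<I> P"
  shows "\<exists>B x \<sigma>. matroid_basis {1..n} \<I> B \<and> x \<in> cake_partitions k \<and>
           bij_betw \<sigma> B {1..k} \<and> (\<forall>j\<in>B. \<sigma> j \<in> P j x)"
proof -
  define good where "good d f x \<longleftrightarrow> x \<in> cake_partitions k \<and>
      (\<forall>i\<in>{1..k}. \<exists>y\<in>cake_partitions k. dist x y < d \<and> i \<in> P (f i) y)" for d f x
  define F where "F = {f \<in> {1..k} \<rightarrow>\<^sub>E {1..n}. inj_on f {1..k} \<and> f ` {1..k} \<in> \<I>}"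
  have finF: "finite F"
    unfolding F_def by (rule finite_subset[OF _ finite_PiE[of "{1..k}" "\<lambda>_. {1..n}"]]) auto
  have ex: "\<exists>f\<in>F. \<exists>x. good d f x" if d: "0 < d" for d
  proof -
    obtain f x where f: "x \<in> cake_partitions k" "inj_on f {1..k}" "f ` {1..k} \<in> \<I>"
      "\<forall>i\<in>{1..k}. f i \<in> {1..n} \<and> (\<exists>y\<in>cake_partitions k. dist x y < d \<and> i \<in> P (f i) y)"
      using approximate_envy_free[OF assms(1-3,7) d] by blast
    then have "good d (restrict f {1..k}) x" by (simp add: good_def)
    moreover have "restrict f {1..k} \<in> F"
      using f by (auto simp: F_def)
    ultimately show ?thesis by blast
  qed
  \<comment> \<open>As \<open>F\<close> is finite, one allocation must serve every tolerance:
    otherwise the least of the failing tolerances would fail for all of \<open>F\<close>, since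
    \<open>good\<close> is preserved when \<open>d\<close> grows.\<close>
  have "\<exists>f\<in>F. \<forall>d>0. \<exists>x. good d f x"
  proof (rule ccontr)
    assume "\<not> ?thesis"
    then obtain \<delta> where \<delta>: "\<And>f. f \<in> F \<Longrightarrow> 0 < \<delta> f \<and> (\<nexists>x. good (\<delta> f) f x)" by metis
    \<comment> \<open>The inserted 1 keeps the set nonempty for \<open>Min\<close>.\<close>
    define d where "d = Min (insert 1 (\<delta> ` F))"
    have "0 < d" using finF \<delta> by (auto simp: d_def)
    then obtain f x where f: "f \<in> F" "good d f x" using ex by blast
    have "d \<le> \<delta> f" using finF f(1) by (auto simp: d_def)
    then have "good (\<delta> f) f x" using f(2) unfolding good_def by (meson less_le_trans)
    then show False using \<delta>[OF f(1)] by blast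
  qed
  then obtain f where f: "f \<in> F" "\<And>d. 0 < d \<Longrightarrow> \<exists>x. good d f x" by blast
  have "\<forall>m. \<exists>x. good (1 / real (Suc m)) f x" using f(2) by simp
  then obtain X where X: "\<And>m. good (1 / real (Suc m)) f (X m)" by metis
  then have "\<forall>m. X m \<in> cake_partitions k" by (simp add: good_def)
  then obtain x h where x: "x \<in> cake_partitions k" "strict_mono h" "(X \<circ> h) \<longlonglongrightarrow> x"
    by (rule seq_compactE[OF compact_imp_seq_compact[OF compact_cake_partitions]])
  have pref: "i \<in> P (f i) x" if i: "i \<in> {1..k}" for i
  proof -
    have "\<forall>m. \<exists>y. y \<in> cake_partitions k \<and> dist (X m) y < 1 / real (Suc m) \<and> i \<in> P (f i) y"
      using X i unfolding good_def by blast
    \<comment> \<open>Each piece has its own witnesses, but all approach \<open>X\<close>, hence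
      along \<open>h\<close> the common limit \<open>x\<close>, where closedness applies.\<close>
    then obtain Y where Y: "\<And>m. Y m \<in> cake_partitions k \<and> dist (X m) (Y m) < 1 / real (Suc m) \<and> i \<in> P (f i) (Y m)"
      by metis
    have inv: "(\<lambda>m. 1 / real (Suc (h m))) \<longlonglongrightarrow> 0"
      using LIMSEQ_subseq_LIMSEQ[OF lim_inverse_n' [THEN LIMSEQ_Suc] x(2)] by (simp add: o_def)
    have bound: "(\<lambda>m. dist ((X \<circ> h) m) x + 1 / real (Suc (h m))) \<longlonglongrightarrow> 0"
      using tendsto_add[OF x(3)[unfolded tendsto_dist_iff[of _ x]] inv] by simp
    have "dist ((Y \<circ> h) m) x \<le> dist ((X \<circ> h) m) x + 1 / real (Suc (h m))" for m
    proof -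
      have "dist ((Y \<circ> h) m) x \<le> dist (X (h m)) (Y (h m)) + dist (X (h m)) x"
        by (metis dist_commute dist_triangle2 o_apply)
      then show ?thesis using Y[of "h m"] by simp
    qed
    then have "(\<lambda>m. dist ((Y \<circ> h) m) x) \<longlonglongrightarrow> 0"
      by (intro tendsto_sandwich[OF _ _ tendsto_const bound] always_eventually) auto
    then have "(Y \<circ> h) \<longlonglongrightarrow> x" by (simp add: tendsto_dist_iff[of _ x])
    then have "\<forall>l. (\<lambda>m. (Y \<circ> h) m l) \<longlonglongrightarrow> x l" by (simp add: tendsto_coordinatewise)
    moreover have "f i \<in> {1..n}" using f(1) i by (auto simp: F_def)
    moreover have "\<forall>m. (Y \<circ> h) m \<in> cake_partitions k \<and> i \<in> P (f i) ((Y \<circ> h) m)" using Y by simp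
    ultimately show ?thesis
      using assms(6) i x(1) unfolding closed_preferences_def by blast
  qed
  \<comment> \<open>\<open>f\<close> sends pieces to guests, so the required allocation is its
    inverse.\<close>
  define B where "B = f ` {1..k}"
  have inj: "inj_on f {1..k}" using f(1) by (simp add: F_def)
  have "matroid_basis {1..n} \<I> B"
    using f(1) assms(2) card_image[OF inj] by (simp add: F_def B_def matroid_basis_def)
  moreover have "bij_betw (the_inv_into {1..k} f) B {1..k}"
    unfolding B_def using inj by (intro bij_betw_the_inv_into inj_on_imp_bij_betw)
  moreover have "\<forall>j\<in>B. the_inv_into {1..k} f j \<in> P j x"
    using pref inj by (auto simp: B_def the_inv_into_f_f)
  ultimately show ?thesis using x(1) by blast
qed

end
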